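(* Let $C$ be a co-Frobenius coalgebra over a field $k$, let $\alpha:C\to C^*$ be an injective morphism of left $C^*$-modules, and let $\circ$ be the multiplication on $C$ defined by $x\circ y=\alpha^{-1}(\alpha(x)\alpha(y))$. Then $(C,\circ)$ is a ring with local units such that the multiplication is a morphism of $(C^*,C^* )$-bimodules, i.e. $(c^*\cdot x)\circ y=c^*\cdot(x\circ y)$ and $x\circ(y\cdot c^* )=(x\circ y)\cdot c^*$ for all $x,y\in C$ and $c^*\in C^*$.
   Context: For a coalgebra $C$ over $k$ with $\Delta(x)=\sum x_1\otimes x_2$, the dual $C^*$ is an algebra with the convolution product $(c^*d^* )(x)=\sum c^*(x_1)d^*(x_2)$. $C$ is a $(C^*,C^* )$-bimodule with $c^*\cdot x=\sum c^*(x_2)x_1$ and $x\cdot c^*=\sum c^*(x_1)x_2$; $C^*$ is a bimodule over itself by multiplication. $C$ is left (respectively right) co-Frobenius if there is an injective morphism of left (respectively right) $C^*$-modules $C\to C^*$; co-Frobenius means left and right co-Frobenius. The rational part of a left (respectively right) $C^*$-module is its largest submodule whose module structure is induced by a right (respectively left) $C$-comodule structure. For a co-Frobenius coalgebra the rational parts of $C^*$ as a left and as a right $C^*$-module coincide; this common subspace is denoted $\mathrm{Rat}(C^* )$ and is a subring (possibly without identity) of $C^*$. Any injective morphism of left $C^*$-modules $\alpha:C\to C^*$ has image exactly $\mathrm{Rat}(C^* )$, and $\alpha^{-1}:\mathrm{Rat}(C^* )\to C$ denotes the inverse of the induced bijection (so that $x\circ y=\alpha(x)\cdot y$). A ring $R$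 (associative, not necessarily with identity) has local units if for any finite subset $X\subseteq R$ there is an idempotent $e\in R$ with $ex=xe=x$ for all $x\in X$. *)

theory Defs
  imports Complex_Main "HOL-Library.Poly_Mapping"
begin

section \<open>Free vector spaces\<close>

text \<open>The free vector space on a type \<open>'b\<close> over the field \<open>'k\<close> is the type of finitely supported
  functions \<open>'b \<Rightarrow>\<^sub>0 'k\<close>; the basis vector attached to \<open>b\<close> is \<^term>\<open>Poly_Mapping.single b 1\<close>.\<close>

definition fscale :: "'k::field \<Rightarrow> ('b \<Rightarrow>\<^sub>0 'k) \<Rightarrow> ('b \<Rightarrow>\<^sub>0 'k)" where
  "fscale c t = Poly_Mapping.map ((*) c) t"

lemma lookup_fscale [simp]:
  "Poly_Mapping.lookup (fscale c t) b = c * Poly_Mapping.lookup t b"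
  by (simp add: fscale_def Poly_Mapping.map.rep_eq when_def)

global_interpretation free: vector_space fscale
  by unfold_locales (auto intro!: poly_mapping_eqI simp: lookup_add algebra_simps)

text \<open>Linear extension of \<open>f\<close>, given on basis vectors, to the free vector space; the target has
  scalar multiplication \<open>s\<close>.\<close>

definition lin_ext ::
  "('k::field \<Rightarrow> 'c \<Rightarrow> 'c) \<Rightarrow> ('b \<Rightarrow> 'c::ab_group_add) \<Rightarrow> ('b \<Rightarrow>\<^sub>0 'k) \<Rightarrow> 'c" where
  "lin_ext s f t = (\<Sum>b\<in>Poly_Mapping.keys t. s (Poly_Mapping.lookup t b) (f b))"


section \<open>Tensor powers\<close>

text \<open>The relators expressing linearity in the slot described by \<open>h\<close>.\<close>

definition slot_relators ::
  "('k::field \<Rightarrow> 'a::ab_group_add \<Rightarrow> 'a) \<Rightarrow> ('a \<Rightarrow> 'b) \<Rightarrow> ('b \<Rightarrow>\<^sub>0 'k) set" where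
  "slot_relators scale h =
     {Poly_Mapping.single (h (x + y)) 1
        - Poly_Mapping.single (h x) 1 - Poly_Mapping.single (h y) 1 | x y. True} \<union>
     {Poly_Mapping.single (h (scale c x)) 1 - fscale c (Poly_Mapping.single (h x) 1) | c x. True}"

definition relators2 ::
  "('k::field \<Rightarrow> 'a::ab_group_add \<Rightarrow> 'a) \<Rightarrow> ('a \<times> 'a \<Rightarrow>\<^sub>0 'k) set" where
  "relators2 scale =
     (\<Union>y. slot_relators scale (\<lambda>x. (x, y))) \<union> (\<Union>x. slot_relators scale (\<lambda>y. (x, y)))"

definition relators3 ::
  "('k::field \<Rightarrow> 'a::ab_group_add \<Rightarrow> 'a) \<Rightarrow> ('a \<times> 'a \<times> 'a \<Rightarrow>\<^sub>0 'k) set" where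
  "relators3 scale =
     (\<Union>y z. slot_relators scale (\<lambda>x. (x, y, z))) \<union>
     (\<Union>x z. slot_relators scale (\<lambda>y. (x, y, z))) \<union>
     (\<Union>x y. slot_relators scale (\<lambda>z. (x, y, z)))"

text \<open>\<open>C \<otimes> C\<close> and \<open>C \<otimes> C \<otimes> C\<close> are the quotients of the free vector spaces on \<open>C \<times> C\<close> and
  \<open>C \<times> C \<times> C\<close> by the spans of the relators, so their elements are cosets.  The functions below
  map a formal linear combination to its coset; the tensor powers are their ranges.\<close>

definition tensor2 ::
  "('k::field \<Rightarrow> 'a::ab_group_add \<Rightarrow> 'a) \<Rightarrow> ('a \<times> 'a \<Rightarrow>\<^sub>0 'k) \<Rightarrow> ('a \<times> 'a \<Rightarrow>\<^sub>0 'k) set" where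
  "tensor2 scale t = {s. s - t \<in> free.span (relators2 scale)}"

definition tensor3 ::
  "('k::field \<Rightarrow> 'a::ab_group_add \<Rightarrow> 'a) \<Rightarrow> ('a \<times> 'a \<times> 'a \<Rightarrow>\<^sub>0 'k)
     \<Rightarrow> ('a \<times> 'a \<times> 'a \<Rightarrow>\<^sub>0 'k) set" where
  "tensor3 scale t = {s. s - t \<in> free.span (relators3 scale)}"

text \<open>A formal sum representing \<open>\<Delta>(x) = \<Sum> x\<^sub>1 \<otimes> x\<^sub>2\<close>.  Linear extensions of bilinear maps do
  not depend on the choice, see lemma \<open>lin_ext_tensor2\<close> below.\<close>

definition sweedler :: "('a \<Rightarrow> ('a \<times> 'a \<Rightarrow>\<^sub>0 'k::field) set) \<Rightarrow> 'a \<Rightarrow> ('a \<times> 'a \<Rightarrow>\<^sub>0 'k)" where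
  "sweedler \<Delta> x = (SOME t. t \<in> \<Delta> x)"


section \<open>Coalgebras\<close>

locale coalgebra = vector_space scale
  for scale :: "'k::field \<Rightarrow> 'a::ab_group_add \<Rightarrow> 'a" +
  fixes \<Delta> :: "'a \<Rightarrow> ('a \<times> 'a \<Rightarrow>\<^sub>0 'k) set"
    and \<epsilon> :: "'a \<Rightarrow> 'k"
  assumes comult_in: "\<Delta> x \<in> range (tensor2 scale)"
    and comult_add: "\<Delta> (x + y) = tensor2 scale (sweedler \<Delta> x + sweedler \<Delta> y)"
    and comult_scale: "\<Delta> (scale c x) = tensor2 scale (fscale c (sweedler \<Delta> x))"
    and counit_linear: "Vector_Spaces.linear scale (*) \<epsilon>"
    and coassoc:
      "tensor3 scale
         (lin_ext fscale (\<lambda>(a, b).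
            lin_ext fscale (\<lambda>(u, v). Poly_Mapping.single (u, v, b) 1) (sweedler \<Delta> a))
          (sweedler \<Delta> x))
       = tensor3 scale
         (lin_ext fscale (\<lambda>(a, b).
            lin_ext fscale (\<lambda>(u, v). Poly_Mapping.single (a, u, v) 1) (sweedler \<Delta> b))
          (sweedler \<Delta> x))"
    and counit_left: "lin_ext scale (\<lambda>(a, b). scale (\<epsilon> a) b) (sweedler \<Delta> x) = x"
    and counit_right: "lin_ext scale (\<lambda>(a, b). scale (\<epsilon> b) a) (sweedler \<Delta> x) = x"

definition dual :: "('k::field \<Rightarrow> 'a::ab_group_add \<Rightarrow> 'a) \<Rightarrow> ('a \<Rightarrow> 'k) set" where
  "dual scale = {f. Vector_Spaces.linear scale (*) f}"

definition conv ::
  "('a \<Rightarrow> ('a \<times> 'a \<Rightarrow>\<^sub>0 'k::field) set) \<Rightarrow> ('a \<Rightarrow> 'k) \<Rightarrow> ('a \<Rightarrow> 'k) \<Rightarrow> 'a \<Rightarrow> 'k" where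
  "conv \<Delta> f g x = lin_ext (*) (\<lambda>(a, b). f a * g b) (sweedler \<Delta> x)"

definition left_act ::
  "('k::field \<Rightarrow> 'a::ab_group_add \<Rightarrow> 'a) \<Rightarrow> ('a \<Rightarrow> ('a \<times> 'a \<Rightarrow>\<^sub>0 'k) set)
     \<Rightarrow> ('a \<Rightarrow> 'k) \<Rightarrow> 'a \<Rightarrow> 'a" where
  "left_act scale \<Delta> f x = lin_ext scale (\<lambda>(a, b). scale (f b) a) (sweedler \<Delta> x)"

definition right_act ::
  "('k::field \<Rightarrow> 'a::ab_group_add \<Rightarrow> 'a) \<Rightarrow> ('a \<Rightarrow> ('a \<times> 'a \<Rightarrow>\<^sub>0 'k) set)
     \<Rightarrow> 'a \<Rightarrow> ('a \<Rightarrow> 'k) \<Rightarrow> 'a" where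
  "right_act scale \<Delta> x f = lin_ext scale (\<lambda>(a, b). scale (f a) b) (sweedler \<Delta> x)"

text \<open>Morphisms of left (right) \<open>C\<^sup>*\<close>-modules from \<open>C\<close> to \<open>C\<^sup>*\<close>.\<close>

definition left_module_hom ::
  "('k::field \<Rightarrow> 'a::ab_group_add \<Rightarrow> 'a) \<Rightarrow> ('a \<Rightarrow> ('a \<times> 'a \<Rightarrow>\<^sub>0 'k) set)
     \<Rightarrow> ('a \<Rightarrow> 'a \<Rightarrow> 'k) \<Rightarrow> bool" where
  "left_module_hom scale \<Delta> \<alpha> \<longleftrightarrow>
     (\<forall>x. \<alpha> x \<in> dual scale) \<and>
     (\<forall>x y. \<alpha> (x + y) = (\<lambda>z. \<alpha> x z + \<alpha> y z)) \<and>
     (\<forall>f\<in>dual scale. \<forall>x. \<alpha> (left_act scale \<Delta> f x) = conv \<Delta> f (\<alpha> x))"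

definition right_module_hom ::
  "('k::field \<Rightarrow> 'a::ab_group_add \<Rightarrow> 'a) \<Rightarrow> ('a \<Rightarrow> ('a \<times> 'a \<Rightarrow>\<^sub>0 'k) set)
     \<Rightarrow> ('a \<Rightarrow> 'a \<Rightarrow> 'k) \<Rightarrow> bool" where
  "right_module_hom scale \<Delta> \<beta> \<longleftrightarrow>
     (\<forall>x. \<beta> x \<in> dual scale) \<and>
     (\<forall>x y. \<beta> (x + y) = (\<lambda>z. \<beta> x z + \<beta> y z)) \<and>
     (\<forall>f\<in>dual scale. \<forall>x. \<beta> (right_act scale \<Delta> x f) = conv \<Delta> (\<beta> x) f)"

definition left_co_Frobenius ::
  "('k::field \<Rightarrow> 'a::ab_group_add \<Rightarrow> 'a) \<Rightarrow> ('a \<Rightarrow> ('a \<times> 'a \<Rightarrow>\<^sub>0 'k) set) \<Rightarrow> bool" where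
  "left_co_Frobenius scale \<Delta> \<longleftrightarrow> (\<exists>\<alpha>. left_module_hom scale \<Delta> \<alpha> \<and> inj \<alpha>)"

definition right_co_Frobenius ::
  "('k::field \<Rightarrow> 'a::ab_group_add \<Rightarrow> 'a) \<Rightarrow> ('a \<Rightarrow> ('a \<times> 'a \<Rightarrow>\<^sub>0 'k) set) \<Rightarrow> bool" where
  "right_co_Frobenius scale \<Delta> \<longleftrightarrow> (\<exists>\<beta>. right_module_hom scale \<Delta> \<beta> \<and> inj \<beta>)"

definition co_Frobenius ::
  "('k::field \<Rightarrow> 'a::ab_group_add \<Rightarrow> 'a) \<Rightarrow> ('a \<Rightarrow> ('a \<times> 'a \<Rightarrow>\<^sub>0 'k) set) \<Rightarrow> bool" where
  "co_Frobenius scale \<Delta> \<longleftrightarrow> left_co_Frobenius scale \<Delta> \<and> right_co_Frobenius scale \<Delta>"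

text \<open>For \<open>\<alpha>\<close> an injective morphism of left modules, \<open>\<alpha> x * \<alpha> y = \<alpha> (\<alpha> x \<cdot> y)\<close> lies in the image
  of \<open>\<alpha>\<close> (which is the rational part of \<open>C\<^sup>*\<close>), so \<open>inv \<alpha>\<close> is only applied where it is the
  inverse of the bijection from \<open>C\<close> onto that image; see lemma \<open>conv_in_range\<close> below.\<close>

definition circ ::
  "('a \<Rightarrow> ('a \<times> 'a \<Rightarrow>\<^sub>0 'k::field) set) \<Rightarrow> ('a \<Rightarrow> 'a \<Rightarrow> 'k) \<Rightarrow> 'a \<Rightarrow> 'a \<Rightarrow> 'a" where
  "circ \<Delta> \<alpha> x y = inv \<alpha> (conv \<Delta> (\<alpha> x) (\<alpha> y))"

definition has_local_units :: "('a \<Rightarrow> 'a \<Rightarrow> 'a) \<Rightarrow> bool" where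
  "has_local_units mult \<longleftrightarrow>
     (\<forall>X. finite X \<longrightarrow> (\<exists>e. mult e e = e \<and> (\<forall>x\<in>X. mult e x = x \<and> mult x e = x)))"


section \<open>Independence of representatives\<close>

lemma lin_ext_superset:
  assumes "vector_space s" "finite A" "Poly_Mapping.keys t \<subseteq> A"
  shows "lin_ext s f t = (\<Sum>b\<in>A. s (Poly_Mapping.lookup t b) (f b))"
proof -
  interpret vector_space s by fact
  show ?thesis unfolding lin_ext_def
    using assms by (intro sum.mono_neutral_left) (auto simp: in_keys_iff)
qed

lemma linear_lin_ext:
  fixes s :: "'k::field \<Rightarrow> 'c::ab_group_add \<Rightarrow> 'c" and f :: "'b \<Rightarrow> 'c"
  assumes "vector_space s"
  shows "Vector_Spaces.linear fscale s (lin_ext s f)"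
proof -
  interpret S: vector_space s by fact
  show ?thesis
  proof (unfold Vector_Spaces.linear_iff, intro conjI allI)
    show "vector_space fscale" by (rule free.vector_space_axioms)
    show "vector_space s" by fact
  next
    fix t u :: "'b \<Rightarrow>\<^sub>0 'k"
    let ?A = "Poly_Mapping.keys t \<union> Poly_Mapping.keys u"
    have "Poly_Mapping.keys (t + u) \<subseteq> ?A" by (rule keys_add)
    then show "lin_ext s f (t + u) = lin_ext s f t + lin_ext s f u"
      by (simp add: lin_ext_superset[OF assms, where A = ?A] lookup_add S.scale_left_distrib
          sum.distrib)
  next
    fix c and t :: "'b \<Rightarrow>\<^sub>0 'k"
    have "Poly_Mapping.keys (fscale c t) \<subseteq> Poly_Mapping.keys t"
      by (auto simp: in_keys_iff)
    then show "lin_ext s f (fscale c t) = s c (lin_ext s f t)"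
      by (simp add: lin_ext_superset[OF assms, where A = "Poly_Mapping.keys t"]
          S.scale_sum_right)
  qed
qed

lemma lin_ext_single [simp]:
  assumes "vector_space s"
  shows "lin_ext s f (Poly_Mapping.single b 1) = f b"
proof -
  interpret vector_space s by fact
  show ?thesis by (simp add: lin_ext_def)
qed

lemma lin_ext_tensor2:
  assumes s: "vector_space s"
    and lin1: "\<And>y. Vector_Spaces.linear scale s (\<lambda>x. f (x, y))"
    and lin2: "\<And>x. Vector_Spaces.linear scale s (\<lambda>y. f (x, y))"
    and "t' \<in> tensor2 scale t"
  shows "lin_ext s f t' = lin_ext s f t"
proof -
  interpret F: Vector_Spaces.linear fscale s "lin_ext s f" by (rule linear_lin_ext[OF s])
  interpret L1: Vector_Spaces.linear scale s "\<lambda>x. f (x, y)" for y by (rule lin1)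
  interpret L2: Vector_Spaces.linear scale s "\<lambda>y. f (x, y)" for x by (rule lin2)
  have "lin_ext s f r = 0" if "r \<in> relators2 scale" for r
    using that
    by (auto simp: relators2_def slot_relators_def F.diff F.scale s L1.add L1.scale L2.add L2.scale)
  then have "lin_ext s f u = 0" if "u \<in> free.span (relators2 scale)" for u
    using F.eq_0_on_span that by blast
  with assms(4) have "lin_ext s f (t' - t) = 0" by (simp add: tensor2_def)
  then show ?thesis by (simp add: F.diff)
qed

lemma conv_in_range:
  "left_module_hom scale \<Delta> \<alpha> \<Longrightarrow> conv \<Delta> (\<alpha> x) (\<alpha> y) \<in> range \<alpha>"
  unfolding left_module_hom_def by (metis rangeI)

end

theory Submission
  imports Defs "HOL-Algebra.Group"
begin

text \<open>Since \<open>\<alpha>\<close> is a morphism of left \<open>C\<^sup>*\<close>-modules, \<open>\<alpha>(x)\<alpha>(y) = \<alpha>(\<alpha>(x) \<cdot> y)\<close>, so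
  \<open>x \<circ> y = \<alpha>(x) \<cdot> y\<close> (lemma \<open>circ_eq_left_act\<close>).  The ring axioms and the two bimodule identities
  are then the statement that \<open>C\<close> is a \<open>(C\<^sup>*,C\<^sup>*)\<close>-bimodule, which follows from coassociativity.

  The substance is the existence of local units.  Let \<open>\<beta> : C \<rightarrow> C\<^sup>*\<close> be an injective morphism of
  right modules, and write \<open>\<phi>(y) = \<beta>(_)(y)\<close> and \<open>\<psi>(w) = \<alpha>(_)(w)\<close> for the transposed maps.  Transposing
  exchanges the sides: \<open>\<phi>\<close> is a morphism of left modules and \<open>\<psi>\<close> one of right modules.  It turns
  injectivity into density: functionals in the image of \<open>\<phi>\<close> (or \<open>\<psi>\<close>) take any values prescribed by
  an element of \<open>C\<^sup>*\<close> on a finite set.  Prescribing the values of \<open>\<epsilon>\<close> gives elements of these images that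
  fix finitely many elements of \<open>C\<close> (\<open>left_approximate_unit\<close>, \<open>right_approximate_unit\<close>).

  Four further steps turn these approximate units into idempotents in the image of \<open>\<alpha>\<close>.

  \<^item> For \<open>u = \<phi>(y)\<close> both \<open>u \<cdot> C\<close> and \<open>C \<cdot> u\<close> are finite-dimensional (\<open>finite_rank\<close>).  The first holds
    because \<open>\<phi>(y) \<cdot> x = y \<cdot> \<beta>(x)\<close> stays in the finite-dimensional module \<open>y \<cdot> C\<^sup>*\<close>.  For the second,
    choose \<open>g = \<psi>(w)\<close> fixing the finite-dimensional space \<open>u \<cdot> C\<close> from the right; then \<open>u = gu = \<psi>(w \<cdot> u)\<close>,
    and \<open>x \<cdot> \<psi>(w') = \<alpha>(x) \<cdot> w'\<close> stays in \<open>C\<^sup>* \<cdot> w'\<close>.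
  \<^item> As \<open>C\<^sup>* \<cdot> y\<close> is finite-dimensional, the powers of \<open>u = \<phi>(y)\<close> satisfy a relation \<open>u\<^sup>n = u\<^sup>n(up)\<close> with
    \<open>p\<close> commuting with \<open>u\<close>.  Then \<open>e = (up)\<^sup>n\<close> is an idempotent in the left ideal \<open>\<phi>(C)\<close>, and it fixes
    whatever \<open>u\<close> fixes (\<open>idempotent_left_unit\<close>).
  \<^item> For such an idempotent \<open>e\<close>, the form \<open>\<alpha>(x)(y)\<close> restricted to \<open>eC \<times> Ce\<close> is nondegenerate in its
    first argument, and \<open>\<beta>(y)(x)\<close> in its second.  So both spaces have the same finite dimension, the first form
    is perfect, and \<open>\<alpha>\<close> maps \<open>eC\<close> onto the functionals on \<open>Ce\<close>.  One of them is \<open>e\<close>, hence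
    \<open>e\<close> lies in the image of \<open>\<alpha>\<close> (\<open>idempotent_in_left_image\<close>).
  \<^item> To have \<open>\<alpha>(x)e = \<alpha>(x)\<close> as well, write \<open>\<alpha>(x) = u\<alpha>(x)\<close> with \<open>u\<close> in \<open>\<phi>(C)\<close> fixing \<open>x\<close>.  As
    \<open>(\<alpha>(x)e)(z) = e(z \<cdot> u \<cdot> \<alpha>(x))\<close> and \<open>C \<cdot> u\<close> is finite-dimensional, it suffices that \<open>e\<close> also fixes
    finitely many further elements (\<open>common_local_unit\<close>).\<close>

section \<open>Linear extensions\<close>

lemma vector_space_mult: "vector_space ((*) :: 'k::field \<Rightarrow> 'k \<Rightarrow> 'k)"
  by unfold_locales (auto simp: algebra_simps)

lemma linear_lin_ext_compose:
  assumes "Vector_Spaces.linear s s' L"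
  shows "L (lin_ext s f t) = lin_ext s' (\<lambda>b. L (f b)) t"
proof -
  interpret L: Vector_Spaces.linear s s' L by fact
  show ?thesis by (simp add: lin_ext_def L.sum L.scale)
qed

text \<open>Linear extensions of trilinear maps vanish on the relators, so they factor through \<open>C \<otimes> C \<otimes> C\<close>; this makes
  coassociativity usable as an identity between Sweedler sums.\<close>
lemma lin_ext_tensor3:
  assumes s: "vector_space s"
    and lin1: "\<And>y z. Vector_Spaces.linear scale s (\<lambda>x. f (x, y, z))"
    and lin2: "\<And>x z. Vector_Spaces.linear scale s (\<lambda>y. f (x, y, z))"
    and lin3: "\<And>x y. Vector_Spaces.linear scale s (\<lambda>z. f (x, y, z))"
    and eq: "tensor3 scale t = tensor3 scale t'"
  shows "lin_ext s f t = lin_ext s f t'"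
proof -
  interpret F: Vector_Spaces.linear fscale s "lin_ext s f" by (rule linear_lin_ext[OF s])
  interpret L1: Vector_Spaces.linear scale s "\<lambda>x. f (x, y, z)" for y z by (rule lin1)
  interpret L2: Vector_Spaces.linear scale s "\<lambda>y. f (x, y, z)" for x z by (rule lin2)
  interpret L3: Vector_Spaces.linear scale s "\<lambda>z. f (x, y, z)" for x y by (rule lin3)
  have "lin_ext s f r = 0" if "r \<in> relators3 scale" for r
    using that
    by (auto simp: relators3_def slot_relators_def F.diff F.scale s
        L1.add L1.scale L2.add L2.scale L3.add L3.scale)
  then have van: "lin_ext s f u = 0" if "u \<in> free.span (relators3 scale)" for u
    using F.eq_0_on_span that by blast
  have "t \<in> tensor3 scale t'"
    unfolding eq[symmetric] by (simp add: tensor3_def free.span_zero)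
  with van have "lin_ext s f (t - t') = 0" by (simp add: tensor3_def)
  then show ?thesis by (simp add: F.diff)
qed

section \<open>Idempotents from stable powers\<close>

text \<open>The multiplicative core of Fitting's lemma.  The hypothesis gives \<open>x\<^sup>n(xp)\<^sup>j = x\<^sup>n\<close> for all \<open>j\<close>, in
  particular \<open>x\<^sup>ne = x\<^sup>n\<close>; multiplying by \<open>p\<^sup>n\<close> yields \<open>ee = e\<close>.  The factorisation of \<open>e\<close> shows that it lies
  in every left ideal containing \<open>x\<^sup>n\<close>.\<close>
lemma (in monoid) power_stable_idempotent:
  assumes x: "x \<in> carrier G" and p: "p \<in> carrier G" and comm: "x \<otimes> p = p \<otimes> x"
    and stable: "x [^] n \<otimes> (x \<otimes> p) = x [^] (n::nat)"
  defines "e \<equiv> (x \<otimes> p) [^] n"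
  shows "e \<otimes> e = e" "e \<otimes> x [^] n = x [^] n" "e = p [^] n \<otimes> x [^] n"
proof -
  have xp: "x \<otimes> p \<in> carrier G" using x p by simp
  have "x [^] n \<otimes> (x \<otimes> p) [^] j = x [^] n" for j :: nat
  proof (induction j)
    case (Suc j)
    have "x [^] n \<otimes> (x \<otimes> p) [^] Suc j = (x [^] n \<otimes> (x \<otimes> p) [^] j) \<otimes> (x \<otimes> p)"
      using x xp by (simp add: m_assoc)
    then show ?case using Suc stable by simp
  qed (use x in simp)
  then have xe: "x [^] n \<otimes> e = x [^] n" by (simp add: e_def)
  have e1: "e = p [^] n \<otimes> x [^] n"
    unfolding e_def comm by (rule pow_mult_distrib) (use x p comm in simp_all)
  have c: "x [^] n \<otimes> p [^] n = p [^] n \<otimes> x [^] n"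
    using pow_mult_distrib[OF comm x p, of n] pow_mult_distrib[OF comm[symmetric] p x, of n] comm
    by simp
  show "e = p [^] n \<otimes> x [^] n" by fact
  have "e \<otimes> e = p [^] n \<otimes> (x [^] n \<otimes> e)"
    using e1 x p by (metis m_assoc nat_pow_closed xp e_def)
  then show "e \<otimes> e = e" using xe e1 by simp
  have "e \<otimes> x [^] n = x [^] n \<otimes> e"
    unfolding e1 using x p c by (metis m_assoc nat_pow_closed)
  then show "e \<otimes> x [^] n = x [^] n" using xe by simp
qed

section \<open>Nondegenerate forms and finite dimension\<close>

context vector_space
begin

lemma finite_basis_of_subspace:
  assumes "finite S" "V \<subseteq> span S"
  obtains B where "B \<subseteq> V" "finite B" "independent B" "V \<subseteq> span B"
proof -
  obtain B where "B \<subseteq> V" "independent B" "V \<subseteq> span B"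
    using maximal_independent_subset by blast
  moreover have "finite B"
    using independent_span_bound[OF assms(1) \<open>independent B\<close>] assms(2) \<open>B \<subseteq> V\<close> by blast
  ultimately show ?thesis using that by blast
qed

text \<open>By induction on \<open>Z\<close>: a nonzero vector of the form \<open>z\<^sub>0\<close> minus a combination of the old basis vectors is
  detected by some \<open>w \<in> W\<close>; correcting \<open>w\<close> by the old dual vectors makes it vanish on \<open>Z\<close> but not on \<open>z\<^sub>0\<close>.\<close>
lemma dual_system:
  assumes "finite Z" "independent Z"
    and lin1: "\<And>w. Vector_Spaces.linear scale (*) (\<lambda>v. b v w)"
    and lin2: "\<And>v. Vector_Spaces.linear scale (*) (b v)"
    and W: "subspace W"
    and nondeg: "\<And>v. v \<in> span Z \<Longrightarrow> v \<noteq> 0 \<Longrightarrow> \<exists>w\<in>W. b v w \<noteq> 0"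
  shows "\<exists>d. \<forall>z\<in>Z. d z \<in> W \<and> (\<forall>z'\<in>Z. b z' (d z) = (if z' = z then 1 else 0))"
  using assms(1,2) nondeg
proof (induction Z rule: finite_induct)
  case empty
  then show ?case by simp
next
  case (insert z0 Z)
  interpret L1: Vector_Spaces.linear scale "(*)" "\<lambda>v. b v w" for w by (rule lin1)
  interpret L2: Vector_Spaces.linear scale "(*)" "b v" for v by (rule lin2)
  have ind: "independent Z" and z0: "z0 \<notin> span Z"
    using insert.prems(1) insert.hyps(2) by (auto simp: independent_insert)
  have sub: "span Z \<subseteq> span (insert z0 Z)" by (intro span_mono) auto
  have "\<exists>w\<in>W. b v w \<noteq> 0" if "v \<in> span Z" "v \<noteq> 0" for v
    using insert.prems(2) sub that by blast
  from insert.IH[OF ind this] obtain d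
    where d: "\<forall>z\<in>Z. d z \<in> W \<and> (\<forall>z'\<in>Z. b z' (d z) = (if z' = z then 1 else 0))" ..
  then have dW: "\<And>z. z \<in> Z \<Longrightarrow> d z \<in> W"
    and dd: "\<And>z z'. z \<in> Z \<Longrightarrow> z' \<in> Z \<Longrightarrow> b z' (d z) = (if z' = z then 1 else 0)"
    by simp_all
  define v where "v = z0 - (\<Sum>z\<in>Z. scale (b z0 (d z)) z)"
  have inZ: "(\<Sum>z\<in>Z. scale (b z0 (d z)) z) \<in> span Z"
    by (intro span_sum span_scale span_base)
  have "v \<noteq> 0" using z0 inZ by (auto simp: v_def)
  moreover have "v \<in> span (insert z0 Z)"
    unfolding v_def using inZ sub by (intro span_diff) (auto intro: span_base)
  ultimately obtain w where w: "w \<in> W" "b v w \<noteq> 0" using insert.prems(2) by blast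
  define w' where "w' = w - (\<Sum>z\<in>Z. scale (b z w) (d z))"
  have w'W: "w' \<in> W" unfolding w'_def
    by (intro subspace_diff[OF W] w subspace_sum[OF W] subspace_scale[OF W] dW)
  have w'0: "b z w' = 0" if "z \<in> Z" for z
  proof -
    have "b z w' = b z w - (\<Sum>y\<in>Z. b y w * b z (d y))"
      by (simp add: w'_def L2.diff L2.sum L2.scale)
    also have "(\<Sum>y\<in>Z. b y w * b z (d y)) = (\<Sum>y\<in>Z. if z = y then b y w else 0)"
      using that by (intro sum.cong) (auto simp: dd)
    finally show ?thesis using insert.hyps(1) that by simp
  qed
  have "b z0 w' = b v w"
    by (simp add: v_def w'_def L2.diff L2.sum L2.scale L1.diff L1.sum L1.scale mult.commute)
  with w have nz: "b z0 w' \<noteq> 0" by simp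
  define y0 where "y0 = scale (inverse (b z0 w')) w'"
  \<comment> \<open>The old dual vectors are corrected so that they vanish on the new basis vector.\<close>
  define d' where "d' z = (if z = z0 then y0 else d z - scale (b z0 (d z)) y0)" for z
  have y0: "y0 \<in> W" "b z0 y0 = 1" "\<And>z. z \<in> Z \<Longrightarrow> b z y0 = 0"
    using nz w'W w'0 by (auto simp: y0_def L2.scale intro: subspace_scale[OF W])
  have "\<forall>z\<in>insert z0 Z. d' z \<in> W \<and>
          (\<forall>z'\<in>insert z0 Z. b z' (d' z) = (if z' = z then 1 else 0))"
    using insert.hyps(2) y0 dd dW
    by (auto simp: d'_def L2.diff L2.scale intro: subspace_diff[OF W] subspace_scale[OF W])
  then show ?case by blast
qed

lemma dual_system_independent:
  assumes "finite Z"
    and lin2: "\<And>v. Vector_Spaces.linear scale (*) (b v)"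
    and dd: "\<And>z z'. z \<in> Z \<Longrightarrow> z' \<in> Z \<Longrightarrow> b z' (d z) = (if z' = z then 1 else 0 :: 'a)"
  shows "inj_on d Z" "independent (d ` Z)"
proof -
  interpret L2: Vector_Spaces.linear scale "(*)" "b v" for v by (rule lin2)
  show inj: "inj_on d Z"
    using dd by (intro inj_onI) (metis zero_neq_one)
  show "independent (d ` Z)"
  proof (subst independent_explicit_finite_subsets, intro allI impI ballI)
    fix T u y
    assume T: "T \<subseteq> d ` Z" "finite T" and s: "(\<Sum>v\<in>T. scale (u v) v) = 0" and "y \<in> T"
    then obtain z where z: "z \<in> Z" "y = d z" by blast
    have "0 = b z (\<Sum>v\<in>T. scale (u v) v)" by (simp add: s L2.zero)
    also have "\<dots> = (\<Sum>v\<in>T. u v * b z v)" by (simp add: L2.sum L2.scale)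
    also have "\<dots> = (\<Sum>v\<in>T. if v = y then u v else 0)"
      using T(1) z dd inj by (intro sum.cong) (auto simp: inj_on_eq_iff)
    finally show "u y = 0" using T(2) \<open>y \<in> T\<close> by simp
  qed
qed

text \<open>A dual system for a basis of \<open>V\<close> is independent in \<open>W\<close>, and conversely, so the two
  one-sided nondegeneracy conditions, although they concern different forms, force equal dimensions.  The
  dual system in \<open>W\<close> is then a basis, and the values of \<open>f\<close> on it are the coefficients of \<open>v\<close>.\<close>
lemma perfect_pairing:
  fixes b c :: "'b \<Rightarrow> 'b \<Rightarrow> 'a"
  assumes V: "subspace V" "finite S" "V \<subseteq> span S" and W: "subspace W" "finite S'" "W \<subseteq> span S'"
    and b1: "\<And>w. Vector_Spaces.linear scale (*) (\<lambda>v. b v w)"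
    and b2: "\<And>v. Vector_Spaces.linear scale (*) (b v)"
    and c1: "\<And>w. Vector_Spaces.linear scale (*) (\<lambda>v. c v w)"
    and c2: "\<And>v. Vector_Spaces.linear scale (*) (c v)"
    and b_nondeg: "\<And>v. v \<in> V \<Longrightarrow> v \<noteq> 0 \<Longrightarrow> \<exists>w\<in>W. b v w \<noteq> 0"
    and c_nondeg: "\<And>w. w \<in> W \<Longrightarrow> w \<noteq> 0 \<Longrightarrow> \<exists>v\<in>V. c v w \<noteq> 0"
    and f: "Vector_Spaces.linear scale (*) f"
  shows "\<exists>v\<in>V. \<forall>w\<in>W. b v w = f w"
proof -
  interpret F: Vector_Spaces.linear scale "(*)" f by (rule f)
  interpret B1: Vector_Spaces.linear scale "(*)" "\<lambda>v. b v w" for w by (rule b1)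
  interpret B2: Vector_Spaces.linear scale "(*)" "b v" for v by (rule b2)
  obtain P where P: "P \<subseteq> V" "finite P" "independent P" "V \<subseteq> span P"
    using finite_basis_of_subspace[OF V(2,3)] by blast
  obtain Q where Q: "Q \<subseteq> W" "finite Q" "independent Q" "W \<subseteq> span Q"
    using finite_basis_of_subspace[OF W(2,3)] by blast
  have sP: "span P \<subseteq> V" and sQ: "span Q \<subseteq> W"
    using P(1) Q(1) V(1) W(1) by (auto intro: span_minimal[THEN subsetD])
  have "\<exists>w\<in>W. b v w \<noteq> 0" if "v \<in> span P" "v \<noteq> 0" for v
    using b_nondeg sP that by blast
  from dual_system[OF P(2,3) b1 b2 W(1) this] obtain d
    where "\<forall>z\<in>P. d z \<in> W \<and> (\<forall>z'\<in>P. b z' (d z) = (if z' = z then 1 else 0))" ..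
  then have dW: "\<And>z. z \<in> P \<Longrightarrow> d z \<in> W"
    and dd: "\<And>z z'. z \<in> P \<Longrightarrow> z' \<in> P \<Longrightarrow> b z' (d z) = (if z' = z then 1 else 0)"
    by simp_all
  have "\<exists>v\<in>V. c v w \<noteq> 0" if "w \<in> span Q" "w \<noteq> 0" for w
    using c_nondeg sQ that by blast
  from dual_system[OF Q(2,3), of "\<lambda>x y. c y x", OF c2 c1 V(1) this] obtain d'
    where "\<forall>z\<in>Q. d' z \<in> V \<and> (\<forall>z'\<in>Q. c (d' z) z' = (if z' = z then 1 else 0))" ..
  then have dV: "\<And>z. z \<in> Q \<Longrightarrow> d' z \<in> V"
    and dd': "\<And>z z'. z \<in> Q \<Longrightarrow> z' \<in> Q \<Longrightarrow> c (d' z) z' = (if z' = z then 1 else 0)"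
    by simp_all
  note D = dual_system_independent[OF P(2) b2 dd]
  note D' = dual_system_independent[OF Q(2), of "\<lambda>x y. c y x", OF c1 dd']
  have "card (d' ` Q) \<le> card P"
    using independent_span_bound[OF P(2) D'(2)] dV P(4) by blast
  then have QP: "card Q \<le> card P" using D'(1) by (simp add: card_image)
  have dQ: "d ` P \<subseteq> span Q" using dW Q(4) by blast
  have "q \<in> span (d ` P)" if "q \<in> W" for q
  proof (rule ccontr)
    assume q: "q \<notin> span (d ` P)"
    then have "independent (insert q (d ` P))" "q \<notin> d ` P"
      using D(2) span_base by (auto simp: independent_insertI)
    moreover have "insert q (d ` P) \<subseteq> span Q" using dQ that Q(4) by blast
    ultimately have "Suc (card P) \<le> card Q"
      using independent_span_bound[OF Q(2), of "insert q (d ` P)"] P(2) D(1)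
      by (simp add: card_image)
    then show False using QP by simp
  qed
  then have Wd: "W \<subseteq> span (d ` P)" by blast
  \<comment> \<open>The expansion of the functional \<open>f\<close> in the basis of \<open>P\<close> dual to \<open>d\<close>.\<close>
  define v where "v = (\<Sum>z\<in>P. scale (f (d z)) z)"
  have vV: "v \<in> V"
    unfolding v_def using P(1) by (intro subspace_sum[OF V(1)] subspace_scale[OF V(1)]) auto
  have "b v y = f y" if "y \<in> d ` P" for y
  proof -
    from that obtain z where z: "z \<in> P" "y = d z" by blast
    have "b v y = (\<Sum>z'\<in>P. f (d z') * b z' (d z))"
      by (simp add: v_def z B1.sum B1.scale)
    also have "\<dots> = (\<Sum>z'\<in>P. if z' = z then f (d z') else 0)"
      using z by (intro sum.cong) (auto simp: dd)
    finally show ?thesis using P(2) z by simp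
  qed
  then have "d ` P \<subseteq> {y. b v y = f y}" by blast
  then have "span (d ` P) \<subseteq> {y. b v y = f y}"
    by (rule span_minimal)
      (simp add: subspace_def B2.add B2.scale B2.zero F.add F.scale F.zero)
  then show ?thesis using vV Wd by blast
qed

text \<open>The density statement: if no nonzero vector is annihilated by all \<open>b(_, w)\<close>, then these functionals
  attain every combination of values on a finite set that some functional attains.\<close>
lemma interpolation:
  fixes b :: "'b \<Rightarrow> 'b \<Rightarrow> 'a"
  assumes b1: "\<And>w. Vector_Spaces.linear scale (*) (\<lambda>v. b v w)"
    and b2: "\<And>v. Vector_Spaces.linear scale (*) (b v)"
    and nondeg: "\<And>v. v \<noteq> 0 \<Longrightarrow> \<exists>w. b v w \<noteq> 0"
    and f: "Vector_Spaces.linear scale (*) f" and "finite Z"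
  shows "\<exists>w. \<forall>z\<in>Z. b z w = f z"
proof -
  interpret F: Vector_Spaces.linear scale "(*)" f by (rule f)
  interpret B1: Vector_Spaces.linear scale "(*)" "\<lambda>v. b v w" for w by (rule b1)
  interpret B2: Vector_Spaces.linear scale "(*)" "b v" for v by (rule b2)
  obtain P where P: "P \<subseteq> span Z" "finite P" "independent P" "span Z \<subseteq> span P"
    using finite_basis_of_subspace[OF \<open>finite Z\<close>, of "span Z"] by blast
  have "\<exists>w\<in>UNIV. b v w \<noteq> 0" if "v \<in> span P" "v \<noteq> 0" for v
    using nondeg that by blast
  from dual_system[OF P(2,3) b1 b2 subspace_UNIV this] obtain d
    where "\<forall>z\<in>P. d z \<in> UNIV \<and> (\<forall>z'\<in>P. b z' (d z) = (if z' = z then 1 else 0))" ..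
  then have dd: "\<And>z z'. z \<in> P \<Longrightarrow> z' \<in> P \<Longrightarrow> b z' (d z) = (if z' = z then 1 else 0)"
    by simp
  define w where "w = (\<Sum>z\<in>P. scale (f z) (d z))"
  have "b z w = f z" if "z \<in> P" for z
  proof -
    have "b z w = (\<Sum>z'\<in>P. f z' * b z (d z'))"
      by (simp add: w_def B2.sum B2.scale)
    also have "\<dots> = (\<Sum>z'\<in>P. if z = z' then f z' else 0)"
      using that by (intro sum.cong) (auto simp: dd)
    finally show ?thesis using P(2) that by simp
  qed
  then have "P \<subseteq> {z. b z w = f z}" by blast
  then have "span P \<subseteq> {z. b z w = f z}"
    by (rule span_minimal)
      (simp add: subspace_def B1.add B1.scale B1.zero F.add F.scale F.zero)
  then show ?thesis using P(4) span_base by blast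
qed

text \<open>If no term depended on later ones, the sequence would be an infinite independent family in a
  finite-dimensional space.\<close>
lemma sequence_tail_dependence:
  assumes "finite S" "\<And>i. y i \<in> span S"
  shows "\<exists>m::nat. y m \<in> span (y ` {m<..})"
proof (rule ccontr)
  assume "\<not> ?thesis"
  then have out: "y m \<notin> span (y ` {m<..})" for m by blast
  have ind: "independent (y ` {..<n})" for n
  proof -
    have "independent (y ` {m..<n})" if "m \<le> n" for m
      using that
    proof (induction m rule: inc_induct)
      case (step m)
      have "{m..<n} = insert m {Suc m..<n}" using step by auto
      moreover have "y m \<notin> span (y ` {Suc m..<n})"
        using out[of m] span_mono[of "y ` {Suc m..<n}" "y ` {m<..}"] by force
      ultimately show ?case using step by (simp add: independent_insertI)
    qed (simp add: independent_empty)
    from this[of 0] show ?thesis by (simp add: atLeast0LessThan)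
  qed
  have "inj y"
  proof (rule linorder_injI)
    fix i j :: nat assume "i < j"
    then have "y j \<in> span (y ` {i<..})" by (intro span_base) auto
    then show "y i \<noteq> y j" using out by metis
  qed
  then have "card (y ` {..<n}) = n" for n
    by (metis card_image card_lessThan inj_on_subset subset_UNIV)
  moreover have "card (y ` {..<Suc (card S)}) \<le> card S"
    using independent_span_bound[OF assms(1) ind, of "Suc (card S)"] assms(2) by blast
  ultimately show False by (metis not_less_eq_eq order_refl)
qed

end

section \<open>The bimodule structure of a coalgebra\<close>

context coalgebra
begin

abbreviation convolution (infixl "\<star>" 70) where "f \<star> g \<equiv> conv \<Delta> f g"
abbreviation hit_left (infixr "\<rightharpoonup>" 74) where "f \<rightharpoonup> x \<equiv> left_act scale \<Delta> f x"
abbreviation hit_right (infixl "\<leftharpoonup>" 73) where "x \<leftharpoonup> f \<equiv> right_act scale \<Delta> x f"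

lemma sweedler_in: "sweedler \<Delta> x \<in> \<Delta> x"
proof -
  obtain t where "\<Delta> x = tensor2 scale t" using comult_in by blast
  then have "t \<in> \<Delta> x" by (simp add: tensor2_def free.span_zero)
  then show ?thesis unfolding sweedler_def by (rule someI)
qed

lemma linear_lin_ext_sweedler:
  assumes s: "vector_space s"
    and lin1: "\<And>y. Vector_Spaces.linear scale s (\<lambda>x. f (x, y))"
    and lin2: "\<And>x. Vector_Spaces.linear scale s (\<lambda>y. f (x, y))"
  shows "Vector_Spaces.linear scale s (\<lambda>x. lin_ext s f (sweedler \<Delta> x))"
proof -
  interpret F: Vector_Spaces.linear fscale s "lin_ext s f" by (rule linear_lin_ext[OF s])
  note wd = lin_ext_tensor2[OF s lin1 lin2]
  show ?thesis
    unfolding Vector_Spaces.linear_iff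
    using s vector_space_axioms wd[OF sweedler_in[of "_ + _", unfolded comult_add]]
      wd[OF sweedler_in[of "scale _ _", unfolded comult_scale]]
    by (simp add: F.add F.scale)
qed

lemma dual_linear: "f \<in> dual scale \<Longrightarrow> Vector_Spaces.linear scale (*) f"
  by (simp add: dual_def)

lemma dual_iff:
  "f \<in> dual scale \<longleftrightarrow> (\<forall>x y. f (x + y) = f x + f y) \<and> (\<forall>c x. f (scale c x) = c * f x)"
  by (simp add: dual_def Vector_Spaces.linear_iff vector_space_axioms vector_space_mult)

lemma counit_dual: "\<epsilon> \<in> dual scale"
  using counit_linear by (simp add: dual_def)

lemma conv_dual: "f \<in> dual scale \<Longrightarrow> g \<in> dual scale \<Longrightarrow> f \<star> g \<in> dual scale"
  unfolding dual_def conv_def[abs_def] mem_Collect_eq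
  by (rule linear_lin_ext_sweedler[OF vector_space_mult])
    (use vector_space_axioms vector_space_mult in
      \<open>simp_all add: Vector_Spaces.linear_iff algebra_simps\<close>)

lemma linear_left_act:
  "f \<in> dual scale \<Longrightarrow> Vector_Spaces.linear scale scale (left_act scale \<Delta> f)"
  unfolding dual_def left_act_def[abs_def] mem_Collect_eq
  by (rule linear_lin_ext_sweedler[OF vector_space_axioms])
    (use vector_space_axioms in
      \<open>simp_all add: Vector_Spaces.linear_iff algebra_simps scale_left_distrib scale_right_distrib\<close>)

lemma linear_right_act:
  "f \<in> dual scale \<Longrightarrow> Vector_Spaces.linear scale scale (\<lambda>x. x \<leftharpoonup> f)"
  unfolding dual_def right_act_def[abs_def] mem_Collect_eq
  by (rule linear_lin_ext_sweedler[OF vector_space_axioms])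
    (use vector_space_axioms in
      \<open>simp_all add: Vector_Spaces.linear_iff algebra_simps scale_left_distrib scale_right_distrib\<close>)

lemma dual_apply_lin_ext:
  "p \<in> dual scale \<Longrightarrow> p (lin_ext scale g t) = lin_ext (*) (\<lambda>b. p (g b)) t"
  by (rule linear_lin_ext_compose) (rule dual_linear)

text \<open>This lemma and the next one move an action to the functional side, where it becomes convolution.  Since functionals
  separate points, every bimodule identity for \<open>C\<close> reduces to associativity of convolution.\<close>
lemma dual_apply_left_act: "p \<in> dual scale \<Longrightarrow> p (f \<rightharpoonup> x) = (p \<star> f) x"
  by (simp add: left_act_def conv_def dual_apply_lin_ext case_prod_unfold dual_iff mult.commute)

lemma dual_apply_right_act: "p \<in> dual scale \<Longrightarrow> p (x \<leftharpoonup> f) = (f \<star> p) x"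
  by (simp add: right_act_def conv_def dual_apply_lin_ext case_prod_unfold dual_iff)

lemma conv_counit_right: "f \<in> dual scale \<Longrightarrow> f \<star> \<epsilon> = f"
  by (rule ext, subst dual_apply_left_act[symmetric]) (simp_all add: left_act_def counit_right)

lemma conv_counit_left: "f \<in> dual scale \<Longrightarrow> \<epsilon> \<star> f = f"
  by (rule ext, subst dual_apply_right_act[symmetric]) (simp_all add: right_act_def counit_left)

lemma conv_assoc:
  assumes "f \<in> dual scale" "g \<in> dual scale" "h \<in> dual scale"
  shows "(f \<star> g) \<star> h = f \<star> (g \<star> h)"
proof
  fix x
  \<comment> \<open>The trilinear form that turns both sides of coassociativity into the triple convolution.\<close>
  define F where "F = (\<lambda>(u, v, w). f u * g v * h w)"
  note L = linear_lin_ext_compose[OF linear_lin_ext[OF vector_space_mult]]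
  have "((f \<star> g) \<star> h) x = lin_ext (*) F (lin_ext fscale (\<lambda>(a, b).
            lin_ext fscale (\<lambda>(u, v). Poly_Mapping.single (u, v, b) 1) (sweedler \<Delta> a))
          (sweedler \<Delta> x))"
    by (simp only: conv_def case_prod_unfold L lin_ext_single[OF vector_space_mult])
      (simp add: F_def lin_ext_def sum_distrib_right mult.assoc)
  also have "\<dots> = lin_ext (*) F (lin_ext fscale (\<lambda>(a, b).
            lin_ext fscale (\<lambda>(u, v). Poly_Mapping.single (a, u, v) 1) (sweedler \<Delta> b))
          (sweedler \<Delta> x))"
    using assms vector_space_axioms vector_space_mult
    by (intro lin_ext_tensor3[OF vector_space_mult _ _ _ coassoc])
      (simp_all add: F_def dual_def Vector_Spaces.linear_iff algebra_simps)
  also have "\<dots> = (f \<star> (g \<star> h)) x"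
    by (simp only: conv_def case_prod_unfold L lin_ext_single[OF vector_space_mult])
      (simp add: F_def lin_ext_def case_prod_unfold sum_distrib_left mult_ac)
  finally show "((f \<star> g) \<star> h) x = (f \<star> (g \<star> h)) x" .
qed

lemma dual_separates:
  assumes "\<And>p. p \<in> dual scale \<Longrightarrow> p x = p y"
  shows "x = y"
proof (rule ccontr)
  assume "x \<noteq> y"
  then have "independent {x - y}" by (simp add: dependent_single)
  interpret P: vector_space_pair scale "(*) :: 'k \<Rightarrow> 'k \<Rightarrow> 'k"
    using vector_space_axioms vector_space_mult by (rule vector_space_pair.intro)
  obtain p where p: "Vector_Spaces.linear scale (*) p" "p (x - y) = 1"
    using P.linear_independent_extend[OF \<open>independent {x - y}\<close>, of "\<lambda>_. 1"] by auto
  interpret p: Vector_Spaces.linear scale "(*)" p by (rule p)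
  show False using p assms[of p] by (simp add: dual_def p.diff)
qed

lemma left_act_counit [simp]: "\<epsilon> \<rightharpoonup> x = x"
  by (simp add: left_act_def counit_right)

lemma right_act_counit [simp]: "x \<leftharpoonup> \<epsilon> = x"
  by (simp add: right_act_def counit_left)

lemma left_act_conv:
  "f \<in> dual scale \<Longrightarrow> g \<in> dual scale \<Longrightarrow> (f \<star> g) \<rightharpoonup> x = f \<rightharpoonup> g \<rightharpoonup> x"
  by (rule dual_separates) (simp add: dual_apply_left_act conv_dual conv_assoc)

lemma right_act_conv:
  "f \<in> dual scale \<Longrightarrow> g \<in> dual scale \<Longrightarrow> x \<leftharpoonup> (f \<star> g) = x \<leftharpoonup> f \<leftharpoonup> g"
  by (rule dual_separates) (simp add: dual_apply_right_act conv_dual conv_assoc)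

lemma left_right_act:
  "f \<in> dual scale \<Longrightarrow> g \<in> dual scale \<Longrightarrow> f \<rightharpoonup> (x \<leftharpoonup> g) = (f \<rightharpoonup> x) \<leftharpoonup> g"
  by (rule dual_separates)
    (simp add: dual_apply_left_act dual_apply_right_act conv_dual conv_assoc)

lemma monoid_dual: "monoid \<lparr>carrier = dual scale, mult = conv \<Delta>, one = \<epsilon>\<rparr>"
  by (rule monoidI)
    (simp_all add: counit_dual conv_dual conv_assoc conv_counit_left conv_counit_right)

text \<open>Finiteness of coalgebras: \<open>f \<cdot> x = \<Sum> f(x\<^sub>2)x\<^sub>1\<close> is a combination of the finitely many left tensor
  factors of one fixed representation of \<open>\<Delta>(x)\<close>.\<close>
lemma left_orbit_finite: "\<exists>S. finite S \<and> (\<forall>f. f \<rightharpoonup> x \<in> span S)"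
  by (intro exI[of _ "fst ` Poly_Mapping.keys (sweedler \<Delta> x)"] conjI allI,
      simp, unfold left_act_def lin_ext_def case_prod_unfold,
      intro span_sum, intro span_scale, intro span_base imageI)

lemma right_orbit_finite: "\<exists>S. finite S \<and> (\<forall>f. x \<leftharpoonup> f \<in> span S)"
  by (intro exI[of _ "snd ` Poly_Mapping.keys (sweedler \<Delta> x)"] conjI allI,
      simp, unfold right_act_def lin_ext_def case_prod_unfold,
      intro span_sum, intro span_scale, intro span_base imageI)

text \<open>The set \<open>S\<close> collects the right tensor factors of \<open>\<Delta>(z)\<close>: on these alone \<open>f \<cdot> z\<close> depends.\<close>
lemma left_act_near_counit:
  assumes "finite Z"
  shows "\<exists>S. finite S \<and> (\<forall>f. (\<forall>s\<in>S. f s = \<epsilon> s) \<longrightarrow> (\<forall>z\<in>Z. f \<rightharpoonup> z = z))"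
proof (intro exI[of _ "\<Union>z\<in>Z. snd ` Poly_Mapping.keys (sweedler \<Delta> z)"] conjI allI impI ballI)
  fix f z
  assume "\<forall>s\<in>\<Union>z\<in>Z. snd ` Poly_Mapping.keys (sweedler \<Delta> z). f s = \<epsilon> s" "z \<in> Z"
  then have "f \<rightharpoonup> z = \<epsilon> \<rightharpoonup> z"
    unfolding left_act_def lin_ext_def case_prod_unfold by (intro sum.cong) auto
  then show "f \<rightharpoonup> z = z" by simp
qed (use assms in simp)

lemma right_act_near_counit:
  assumes "finite Z"
  shows "\<exists>S. finite S \<and> (\<forall>f. (\<forall>s\<in>S. f s = \<epsilon> s) \<longrightarrow> (\<forall>z\<in>Z. z \<leftharpoonup> f = z))"
proof (intro exI[of _ "\<Union>z\<in>Z. fst ` Poly_Mapping.keys (sweedler \<Delta> z)"] conjI allI impI ballI)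
  fix f z
  assume "\<forall>s\<in>\<Union>z\<in>Z. fst ` Poly_Mapping.keys (sweedler \<Delta> z). f s = \<epsilon> s" "z \<in> Z"
  then have "z \<leftharpoonup> f = z \<leftharpoonup> \<epsilon>"
    unfolding right_act_def lin_ext_def case_prod_unfold by (intro sum.cong) auto
  then show "z \<leftharpoonup> f = z" by simp
qed (use assms in simp)

lemma dual_add: "f \<in> dual scale \<Longrightarrow> g \<in> dual scale \<Longrightarrow> (\<lambda>x. f x + g x) \<in> dual scale"
  and dual_scale: "f \<in> dual scale \<Longrightarrow> (\<lambda>x. c * f x) \<in> dual scale"
  by (simp_all add: dual_iff algebra_simps)

lemma left_act_add: "(\<lambda>x. f x + g x) \<rightharpoonup> x = f \<rightharpoonup> x + g \<rightharpoonup> x"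
  by (simp add: left_act_def lin_ext_def case_prod_unfold scale_left_distrib
      scale_right_distrib sum.distrib)

lemma left_act_scale: "(\<lambda>x. c * f x) \<rightharpoonup> x = scale c (f \<rightharpoonup> x)"
  by (simp add: left_act_def lin_ext_def case_prod_unfold scale_sum_right mult_ac)

lemma right_act_scale: "x \<leftharpoonup> (\<lambda>x. c * f x) = scale c (x \<leftharpoonup> f)"
  by (simp add: right_act_def lin_ext_def case_prod_unfold scale_sum_right mult_ac)

lemma conv_add_left: "(\<lambda>x. f x + g x) \<star> h = (\<lambda>x. (f \<star> h) x + (g \<star> h) x)"
  and conv_add_right: "h \<star> (\<lambda>x. f x + g x) = (\<lambda>x. (h \<star> f) x + (h \<star> g) x)"
  and conv_scale_left: "(\<lambda>x. c * f x) \<star> h = (\<lambda>x. c * (f \<star> h) x)"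
  and conv_scale_right: "h \<star> (\<lambda>x. c * f x) = (\<lambda>x. c * (h \<star> f) x)"
  by (auto simp: conv_def lin_ext_def case_prod_unfold algebra_simps sum.distrib sum_distrib_left)

section \<open>Module morphisms and their transposes\<close>
lemma left_hom_dual: "left_module_hom scale \<Delta> \<alpha> \<Longrightarrow> \<alpha> x \<in> dual scale"
  and left_hom_act: "left_module_hom scale \<Delta> \<alpha> \<Longrightarrow> f \<in> dual scale \<Longrightarrow> \<alpha> (f \<rightharpoonup> x) = f \<star> \<alpha> x"
  by (simp_all add: left_module_hom_def)

lemma right_hom_dual: "right_module_hom scale \<Delta> \<beta> \<Longrightarrow> \<beta> x \<in> dual scale"
  and right_hom_act: "right_module_hom scale \<Delta> \<beta> \<Longrightarrow> f \<in> dual scale \<Longrightarrow> \<beta> (x \<leftharpoonup> f) = \<beta> x \<star> f"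
  by (simp_all add: right_module_hom_def)

text \<open>Homogeneity of \<open>\<alpha>\<close> comes from the action of \<open>c\<epsilon>\<close>, which is
  multiplication by the scalar \<open>c\<close>.\<close>
lemma left_hom_flip_dual:
  assumes "left_module_hom scale \<Delta> \<alpha>"
  shows "(\<lambda>x. \<alpha> x y) \<in> dual scale"
proof -
  have "\<alpha> (scale c x) = (\<lambda>z. c * \<alpha> x z)" for c x
  proof -
    have "\<alpha> (scale c x) = \<alpha> ((\<lambda>z. c * \<epsilon> z) \<rightharpoonup> x)"
      by (simp add: left_act_scale)
    also have "\<dots> = (\<lambda>z. c * \<alpha> x z)"
      using assms by (simp add: left_hom_act left_hom_dual dual_scale counit_dual
          conv_scale_left conv_counit_left)
    finally show ?thesis .
  qed
  with assms show ?thesis by (simp add: dual_iff left_module_hom_def)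
qed

lemma right_hom_flip_dual:
  assumes "right_module_hom scale \<Delta> \<beta>"
  shows "(\<lambda>x. \<beta> x y) \<in> dual scale"
proof -
  have "\<beta> (scale c x) = (\<lambda>z. c * \<beta> x z)" for c x
  proof -
    have "\<beta> (scale c x) = \<beta> (x \<leftharpoonup> (\<lambda>z. c * \<epsilon> z))"
      by (simp add: right_act_scale)
    also have "\<dots> = (\<lambda>z. c * \<beta> x z)"
      using assms by (simp add: right_hom_act right_hom_dual dual_scale counit_dual
          conv_scale_right conv_counit_right)
    finally show ?thesis .
  qed
  with assms show ?thesis by (simp add: dual_iff right_module_hom_def)
qed

text \<open>Both module conditions say that the form \<open>\<alpha>(x)(y)\<close> is balanced,
  \<open>\<alpha>(f \<cdot> x)(y) = \<alpha>(x)(y \<cdot> f)\<close>, a condition symmetric under transposition and exchange of sides.\<close>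
lemma right_hom_flip:
  assumes "left_module_hom scale \<Delta> \<alpha>"
  shows "right_module_hom scale \<Delta> (\<lambda>y x. \<alpha> x y)"
  unfolding right_module_hom_def
proof (intro conjI allI ballI ext)
  fix f y x assume f: "f \<in> dual scale"
  have "\<alpha> x (y \<leftharpoonup> f) = \<alpha> (f \<rightharpoonup> x) y"
    using assms f by (simp add: dual_apply_right_act left_hom_dual left_hom_act)
  also have "\<dots> = ((\<lambda>x. \<alpha> x y) \<star> f) x"
    using dual_apply_left_act[OF left_hom_flip_dual[OF assms]] by simp
  finally show "\<alpha> x (y \<leftharpoonup> f) = ((\<lambda>x. \<alpha> x y) \<star> f) x" .
qed (use assms in \<open>simp_all add: left_hom_flip_dual left_hom_dual[unfolded dual_iff]\<close>)

lemma left_hom_flip: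
  assumes "right_module_hom scale \<Delta> \<beta>"
  shows "left_module_hom scale \<Delta> (\<lambda>y x. \<beta> x y)"
  unfolding left_module_hom_def
proof (intro conjI allI ballI ext)
  fix f y x assume f: "f \<in> dual scale"
  have "\<beta> x (f \<rightharpoonup> y) = \<beta> (x \<leftharpoonup> f) y"
    using assms f by (simp add: dual_apply_left_act right_hom_dual right_hom_act)
  also have "\<dots> = (f \<star> (\<lambda>x. \<beta> x y)) x"
    using dual_apply_right_act[OF right_hom_flip_dual[OF assms]] by simp
  finally show "\<beta> x (f \<rightharpoonup> y) = (f \<star> (\<lambda>x. \<beta> x y)) x" .
qed (use assms in \<open>simp_all add: right_hom_flip_dual right_hom_dual[unfolded dual_iff]\<close>)

text \<open>The two sides have equal values under every functional \<open>p\<close> because both reduce to \<open>\<beta>(x)(p \<cdot> y)\<close>.  The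
  point of the identity is that the right-hand side remains in \<open>y \<cdot> C\<^sup>*\<close> for all \<open>x\<close>.\<close>
lemma flip_left_act:
  assumes "right_module_hom scale \<Delta> \<beta>"
  shows "(\<lambda>z. \<beta> z y) \<rightharpoonup> x = y \<leftharpoonup> \<beta> x"
proof (rule dual_separates)
  fix p assume p: "p \<in> dual scale"
  have "p ((\<lambda>z. \<beta> z y) \<rightharpoonup> x) = \<beta> x (p \<rightharpoonup> y)"
    using left_hom_act[OF left_hom_flip[OF assms] p, of y] p
    by (metis dual_apply_left_act)
  also have "\<dots> = p (y \<leftharpoonup> \<beta> x)"
    using p assms by (simp add: dual_apply_left_act dual_apply_right_act right_hom_dual)
  finally show "p ((\<lambda>z. \<beta> z y) \<rightharpoonup> x) = p (y \<leftharpoonup> \<beta> x)" .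
qed

lemma flip_right_act:
  assumes "left_module_hom scale \<Delta> \<alpha>"
  shows "y \<leftharpoonup> (\<lambda>z. \<alpha> z w) = \<alpha> y \<rightharpoonup> w"
proof (rule dual_separates)
  fix p assume p: "p \<in> dual scale"
  have "p (y \<leftharpoonup> (\<lambda>z. \<alpha> z w)) = \<alpha> y (w \<leftharpoonup> p)"
    using right_hom_act[OF right_hom_flip[OF assms] p, of w] p
    by (metis dual_apply_right_act)
  also have "\<dots> = p (\<alpha> y \<rightharpoonup> w)"
    using p assms by (simp add: dual_apply_left_act dual_apply_right_act left_hom_dual)
  finally show "p (y \<leftharpoonup> (\<lambda>z. \<alpha> z w)) = p (\<alpha> y \<rightharpoonup> w)" .
qed

lemma left_hom_nondegenerate:
  assumes "left_module_hom scale \<Delta> \<alpha>" "inj \<alpha>" "x \<noteq> 0"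
  shows "\<exists>y. \<alpha> x y \<noteq> 0"
proof -
  have "\<alpha> (0 + 0) = (\<lambda>z. \<alpha> 0 z + \<alpha> 0 z)"
    using assms(1) unfolding left_module_hom_def by blast
  then have "\<alpha> 0 z = 0" for z by (metis add_0 add_cancel_right_right)
  then show ?thesis using assms(2,3) by (metis ext injD)
qed

lemma right_hom_nondegenerate:
  assumes "right_module_hom scale \<Delta> \<beta>" "inj \<beta>" "x \<noteq> 0"
  shows "\<exists>y. \<beta> x y \<noteq> 0"
proof -
  have "\<beta> (0 + 0) = (\<lambda>z. \<beta> 0 z + \<beta> 0 z)"
    using assms(1) unfolding right_module_hom_def by blast
  then have "\<beta> 0 z = 0" for z by (metis add_0 add_cancel_right_right)
  then show ?thesis using assms(2,3) by (metis ext injD)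
qed

section \<open>Approximate units and finite rank\<close>
lemma left_approximate_unit:
  assumes "right_module_hom scale \<Delta> \<beta>" "inj \<beta>" "finite Z"
  shows "\<exists>y. \<forall>z\<in>Z. (\<lambda>x. \<beta> x y) \<rightharpoonup> z = z"
proof -
  obtain S where S: "finite S" "\<And>f. (\<forall>s\<in>S. f s = \<epsilon> s) \<Longrightarrow> \<forall>z\<in>Z. f \<rightharpoonup> z = z"
    using left_act_near_counit[OF assms(3)] by blast
  have "\<exists>w. \<forall>s\<in>S. \<beta> s w = \<epsilon> s"
  proof (rule interpolation)
    show "Vector_Spaces.linear scale (*) (\<lambda>v. \<beta> v w)" for w
      by (rule dual_linear) (rule right_hom_flip_dual[OF assms(1)])
    show "Vector_Spaces.linear scale (*) (\<beta> v)" for v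
      by (rule dual_linear) (rule right_hom_dual[OF assms(1)])
  qed (use S(1) counit_linear right_hom_nondegenerate[OF assms(1,2)] in simp_all)
  then obtain y where "\<forall>s\<in>S. \<beta> s y = \<epsilon> s" ..
  then show ?thesis using S(2)[of "\<lambda>x. \<beta> x y"] by (intro exI[of _ y])
qed

lemma right_approximate_unit:
  assumes "left_module_hom scale \<Delta> \<alpha>" "inj \<alpha>" "finite Z"
  shows "\<exists>w. \<forall>z\<in>Z. z \<leftharpoonup> (\<lambda>x. \<alpha> x w) = z"
proof -
  obtain S where S: "finite S" "\<And>f. (\<forall>s\<in>S. f s = \<epsilon> s) \<Longrightarrow> \<forall>z\<in>Z. z \<leftharpoonup> f = z"
    using right_act_near_counit[OF assms(3)] by blast
  have "\<exists>w. \<forall>s\<in>S. \<alpha> s w = \<epsilon> s"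
  proof (rule interpolation)
    show "Vector_Spaces.linear scale (*) (\<lambda>v. \<alpha> v w)" for w
      by (rule dual_linear) (rule left_hom_flip_dual[OF assms(1)])
    show "Vector_Spaces.linear scale (*) (\<alpha> v)" for v
      by (rule dual_linear) (rule left_hom_dual[OF assms(1)])
  qed (use S(1) counit_linear left_hom_nondegenerate[OF assms(1,2)] in simp_all)
  then obtain w where "\<forall>s\<in>S. \<alpha> s w = \<epsilon> s" ..
  then show ?thesis using S(2)[of "\<lambda>x. \<alpha> x w"] by (intro exI[of _ w])
qed

lemma right_act_fixes_span:
  assumes f: "f \<in> dual scale" and fixed: "\<And>z. z \<in> Z \<Longrightarrow> z \<leftharpoonup> f = z" and "z \<in> span Z"
  shows "z \<leftharpoonup> f = z"
proof -
  interpret L: Vector_Spaces.linear scale scale "\<lambda>x. x \<leftharpoonup> f" by (rule linear_right_act[OF f])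
  have "span Z \<subseteq> {z. z \<leftharpoonup> f = z}"
    by (rule span_minimal) (use fixed in \<open>auto simp: subspace_def L.add L.scale L.zero\<close>)
  then show ?thesis using assms(3) by blast
qed

text \<open>In the language of rational modules: an element \<open>u\<close> of the transposed image of \<open>\<beta>\<close>, which is rational on one side by
  construction, is rational on the other side too.  Here \<open>\<alpha>\<close> enters through the
  elements \<open>g = \<alpha>(_)(w)\<close> that absorb \<open>u\<close>.\<close>
lemma finite_rank:
  assumes \<alpha>: "left_module_hom scale \<Delta> \<alpha>" "inj \<alpha>" and \<beta>: "right_module_hom scale \<Delta> \<beta>"
  defines "u \<equiv> (\<lambda>y x. \<beta> x y)"
  shows "\<exists>S. finite S \<and> (\<forall>x. u y \<rightharpoonup> x \<in> span S)" "\<exists>S. finite S \<and> (\<forall>x. x \<leftharpoonup> u y \<in> span S)"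
proof -
  have uD: "u y \<in> dual scale" unfolding u_def by (rule right_hom_flip_dual[OF \<beta>])
  obtain S where S: "finite S" "\<And>f. y \<leftharpoonup> f \<in> span S" using right_orbit_finite by blast
  then have V: "range (\<lambda>x. u y \<rightharpoonup> x) \<subseteq> span S"
    using flip_left_act[OF \<beta>, of y] by (auto simp: u_def)
  then show "\<exists>S. finite S \<and> (\<forall>x. u y \<rightharpoonup> x \<in> span S)" using S(1) by blast
  obtain w where w: "\<forall>z\<in>S. z \<leftharpoonup> (\<lambda>x. \<alpha> x w) = z"
    using right_approximate_unit[OF \<alpha> S(1)] by blast
  define g where "g = (\<lambda>x. \<alpha> x w)"
  have gD: "g \<in> dual scale" unfolding g_def by (rule left_hom_flip_dual[OF \<alpha>(1)])
  have fixg: "(u y \<rightharpoonup> x) \<leftharpoonup> g = u y \<rightharpoonup> x" for x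
    by (rule right_act_fixes_span[OF gD, where Z = S]) (use w V in \<open>auto simp: g_def\<close>)
  \<comment> \<open>Fixing \<open>u \<cdot> C\<close> from the right amounts to a left unit for \<open>u\<close>: compare counits.\<close>
  have "u y = g \<star> u y"
  proof
    fix x
    have "u y x = \<epsilon> (u y \<rightharpoonup> x)"
      by (simp add: dual_apply_left_act counit_dual conv_counit_left uD)
    also have "\<dots> = \<epsilon> ((u y \<rightharpoonup> x) \<leftharpoonup> g)" by (simp add: fixg)
    also have "\<dots> = (g \<star> u y) x"
      by (simp add: dual_apply_right_act dual_apply_left_act counit_dual conv_counit_right gD)
    finally show "u y x = (g \<star> u y) x" .
  qed
  also have "g \<star> u y = (\<lambda>x. \<alpha> x (w \<leftharpoonup> u y))"
    using right_hom_act[OF right_hom_flip[OF \<alpha>(1)] uD] by (simp add: g_def)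
  finally have uy: "u y = (\<lambda>x. \<alpha> x (w \<leftharpoonup> u y))" .
  have "x \<leftharpoonup> u y = \<alpha> x \<rightharpoonup> (w \<leftharpoonup> u y)" for x
    by (subst uy) (rule flip_right_act[OF \<alpha>(1)])
  then show "\<exists>S. finite S \<and> (\<forall>x. x \<leftharpoonup> u y \<in> span S)"
    using left_orbit_finite[of "w \<leftharpoonup> u y"] by metis
qed

section \<open>Idempotents in the image\<close>

text \<open>The relation \<open>u\<^sup>n = u\<^sup>n(up)\<close> is found inside \<open>C\<^sup>* \<cdot> y\<close>, where \<open>u\<^sup>m \<cdot> y\<close> depends
  linearly on the later \<open>u\<^sup>i \<cdot> y\<close>, and carried over to \<open>C\<^sup>*\<close> by the transpose \<open>\<phi>\<close> of \<open>\<beta>\<close>, which sends \<open>u\<^sup>i \<cdot> y\<close> to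
  \<open>u\<^bsup>i+1\<^esup>\<close>.\<close>
lemma idempotent_left_unit:
  assumes \<beta>: "right_module_hom scale \<Delta> \<beta>" "inj \<beta>" and "finite Z"
  shows "\<exists>y. (\<lambda>x. \<beta> x y) \<star> (\<lambda>x. \<beta> x y) = (\<lambda>x. \<beta> x y) \<and> (\<forall>z\<in>Z. (\<lambda>x. \<beta> x y) \<rightharpoonup> z = z)"
proof -
  define \<phi> where "\<phi> = (\<lambda>y x. \<beta> x y)"
  have \<phi>: "left_module_hom scale \<Delta> \<phi>" unfolding \<phi>_def by (rule left_hom_flip[OF \<beta>(1)])
  obtain y where y: "\<And>z. z \<in> Z \<Longrightarrow> \<phi> y \<rightharpoonup> z = z"
    using left_approximate_unit[OF \<beta> assms(3)] by (auto simp: \<phi>_def)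
  define u where "u = \<phi> y"
  define A where "A = \<lparr>carrier = dual scale, mult = conv \<Delta>, one = \<epsilon>\<rparr>"
  interpret A: monoid A unfolding A_def by (rule monoid_dual)
  have carr [simp]: "carrier A = dual scale" and mult [simp]: "mult A = conv \<Delta>"
    and one [simp]: "one A = \<epsilon>"
    by (simp_all add: A_def)
  have uD: "u \<in> dual scale" unfolding u_def by (rule left_hom_dual[OF \<phi>])
  have pD: "f [^]\<^bsub>A\<^esub> i \<in> dual scale" if "f \<in> dual scale" for f and i :: nat
    using A.nat_pow_closed[of f i] that by simp
  obtain S where S: "finite S" "\<And>f. f \<rightharpoonup> y \<in> span S" using left_orbit_finite by blast
  from sequence_tail_dependence[OF S(1), of "\<lambda>i. u [^]\<^bsub>A\<^esub> i \<rightharpoonup> y", OF S(2)]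
  obtain m :: nat where m: "u [^]\<^bsub>A\<^esub> m \<rightharpoonup> y \<in> span ((\<lambda>i. u [^]\<^bsub>A\<^esub> i \<rightharpoonup> y) ` {m<..})" ..
  define n where "n = Suc m"
  \<comment> \<open>This subspace contains \<open>u\<^sup>nq(u) \<cdot> y\<close> for every polynomial \<open>q\<close>; remembering only that
    \<open>p\<close> commutes with \<open>u\<close> avoids polynomial calculus.\<close>
  define K where "K = {z. \<exists>p\<in>dual scale. u \<star> p = p \<star> u \<and> z = (u [^]\<^bsub>A\<^esub> n \<star> p) \<rightharpoonup> y}"
  have "subspace K"
  proof (rule subspaceI)
    have "u \<star> (\<lambda>x. 0) = (\<lambda>x. 0) \<star> u" "(u [^]\<^bsub>A\<^esub> n \<star> (\<lambda>x. 0)) \<rightharpoonup> y = 0"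
      by (auto simp: conv_def left_act_def lin_ext_def case_prod_unfold)
    moreover have "(\<lambda>x. 0) \<in> dual scale" by (simp add: dual_iff)
    ultimately show "0 \<in> K" unfolding K_def by fastforce
  next
    fix z z' assume "z \<in> K" "z' \<in> K"
    then obtain p p' where "p \<in> dual scale" "u \<star> p = p \<star> u" "z = (u [^]\<^bsub>A\<^esub> n \<star> p) \<rightharpoonup> y"
      "p' \<in> dual scale" "u \<star> p' = p' \<star> u" "z' = (u [^]\<^bsub>A\<^esub> n \<star> p') \<rightharpoonup> y"
      unfolding K_def by blast
    then show "z + z' \<in> K" unfolding K_def
      by (intro CollectI bexI[of _ "\<lambda>x. p x + p' x"])
        (simp_all add: conv_add_left conv_add_right left_act_add dual_add)
  next
    fix c z assume "z \<in> K"
    then obtain p where "p \<in> dual scale" "u \<star> p = p \<star> u" "z = (u [^]\<^bsub>A\<^esub> n \<star> p) \<rightharpoonup> y"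
      unfolding K_def by blast
    then show "scale c z \<in> K" unfolding K_def
      by (intro CollectI bexI[of _ "\<lambda>x. c * p x"])
        (simp_all add: conv_scale_left conv_scale_right left_act_scale dual_scale)
  qed
  moreover have "(\<lambda>i. u [^]\<^bsub>A\<^esub> i \<rightharpoonup> y) ` {m<..} \<subseteq> K"
  proof (rule image_subsetI)
    fix i assume "i \<in> {m<..}"
    then obtain j where j: "i = n + j" unfolding n_def by (metis Suc_leI greaterThan_iff le_Suc_ex)
    have "u \<star> u [^]\<^bsub>A\<^esub> j = u [^]\<^bsub>A\<^esub> j \<star> u"
      using A.nat_pow_Suc2[of u j] A.nat_pow_Suc[of u j] uD by simp
    moreover have "u [^]\<^bsub>A\<^esub> i = u [^]\<^bsub>A\<^esub> n \<star> u [^]\<^bsub>A\<^esub> j"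
      using A.nat_pow_mult[of u n j] uD by (simp add: j)
    ultimately show "u [^]\<^bsub>A\<^esub> i \<rightharpoonup> y \<in> K" unfolding K_def using pD[OF uD] by auto
  qed
  ultimately have "u [^]\<^bsub>A\<^esub> m \<rightharpoonup> y \<in> K" using m span_minimal by blast
  then obtain p where p: "p \<in> dual scale" "u \<star> p = p \<star> u"
    and um: "u [^]\<^bsub>A\<^esub> m \<rightharpoonup> y = (u [^]\<^bsub>A\<^esub> n \<star> p) \<rightharpoonup> y"
    unfolding K_def by blast
  have hom: "\<phi> (f \<rightharpoonup> y) = f \<star> u" if "f \<in> dual scale" for f
    using left_hom_act[OF \<phi> that] by (simp add: u_def)
  have un: "u [^]\<^bsub>A\<^esub> n = u [^]\<^bsub>A\<^esub> m \<star> u" by (simp add: n_def)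
  also have "\<dots> = (u [^]\<^bsub>A\<^esub> n \<star> p) \<star> u"
    using um hom pD uD p conv_dual by metis
  finally have stable: "u [^]\<^bsub>A\<^esub> n \<star> (u \<star> p) = u [^]\<^bsub>A\<^esub> n"
    using p uD pD by (simp add: conv_assoc)
  define e where "e = (u \<star> p) [^]\<^bsub>A\<^esub> n"
  note E = A.power_stable_idempotent[of u p n, unfolded carr mult, OF uD p stable, folded e_def]
  have eD: "e \<in> dual scale" unfolding e_def using uD p pD conv_dual by simp
  have "e = (p [^]\<^bsub>A\<^esub> n \<star> u [^]\<^bsub>A\<^esub> m) \<star> u"
    using E(3) un p uD pD by (simp add: conv_assoc)
  then have e: "e = \<phi> ((p [^]\<^bsub>A\<^esub> n \<star> u [^]\<^bsub>A\<^esub> m) \<rightharpoonup> y)"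
    using hom conv_dual p uD pD by simp
  have "e \<rightharpoonup> z = z" if "z \<in> Z" for z
  proof -
    have "u [^]\<^bsub>A\<^esub> i \<rightharpoonup> z = z" for i :: nat
      using y[OF that] by (induction i) (simp_all add: left_act_conv pD uD flip: u_def)
    then show ?thesis using E(2) left_act_conv[OF eD pD[OF uD, of n], of z] by simp
  qed
  then show ?thesis using E(1) e unfolding \<phi>_def by metis
qed

text \<open>The functional \<open>e\<close> restricted to \<open>Ce\<close> is represented by a vector of \<open>eC\<close> through the form
  \<open>\<alpha>(x)(y)\<close>.  Both that vector's image and \<open>e\<close> are unchanged by \<open>w \<mapsto> w \<cdot> e\<close>, so they agree on all of \<open>C\<close>.\<close>
lemma idempotent_in_left_image:
  assumes \<alpha>: "left_module_hom scale \<Delta> \<alpha>" "inj \<alpha>" and \<beta>: "right_module_hom scale \<Delta> \<beta>" "inj \<beta>"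
    and e: "e = (\<lambda>x. \<beta> x y)" and idem: "e \<star> e = e"
  shows "e \<in> range \<alpha>"
proof -
  have eD: "e \<in> dual scale" unfolding e by (rule right_hom_flip_dual[OF \<beta>(1)])
  interpret L: Vector_Spaces.linear scale scale "left_act scale \<Delta> e" by (rule linear_left_act[OF eD])
  interpret R: Vector_Spaces.linear scale scale "\<lambda>x. x \<leftharpoonup> e" by (rule linear_right_act[OF eD])
  obtain S where S: "finite S" "\<And>x. e \<rightharpoonup> x \<in> span S"
    using finite_rank(1)[OF \<alpha> \<beta>(1)] unfolding e by blast
  obtain S' where S': "finite S'" "\<And>x. x \<leftharpoonup> e \<in> span S'"
    using finite_rank(2)[OF \<alpha> \<beta>(1)] unfolding e by blast
  have ee: "e \<rightharpoonup> e \<rightharpoonup> x = e \<rightharpoonup> x" "x \<leftharpoonup> e \<leftharpoonup> e = x \<leftharpoonup> e" for x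
    using left_act_conv[OF eD eD] right_act_conv[OF eD eD] idem by simp_all
  have a: "\<alpha> (e \<rightharpoonup> x) z = \<alpha> x (z \<leftharpoonup> e)" for x z
    using \<alpha>(1) eD by (simp add: left_hom_act dual_apply_right_act left_hom_dual)
  have b: "\<beta> (x \<leftharpoonup> e) z = \<beta> x (e \<rightharpoonup> z)" for x z
    using \<beta>(1) eD by (simp add: right_hom_act dual_apply_left_act right_hom_dual)
  have "\<exists>v\<in>range (left_act scale \<Delta> e). \<forall>w\<in>range (\<lambda>x. x \<leftharpoonup> e). \<alpha> v w = e w"
  proof (rule perfect_pairing[where c = "\<lambda>v w. \<beta> w v"])
    show "subspace (range (left_act scale \<Delta> e))" "subspace (range (\<lambda>x. x \<leftharpoonup> e))"
      using L.subspace_image R.subspace_image subspace_UNIV by blast+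
    show "\<exists>w\<in>range (\<lambda>x. x \<leftharpoonup> e). \<alpha> v w \<noteq> 0" if "v \<in> range (left_act scale \<Delta> e)" "v \<noteq> 0" for v
    proof -
      from left_hom_nondegenerate[OF \<alpha> that(2)] obtain z where "\<alpha> v z \<noteq> 0" ..
      moreover have "e \<rightharpoonup> v = v" using that(1) ee(1) by auto
      ultimately have "\<alpha> v (z \<leftharpoonup> e) \<noteq> 0" using a[of v z] by simp
      then show ?thesis by blast
    qed
    show "\<exists>v\<in>range (left_act scale \<Delta> e). \<beta> w v \<noteq> 0" if "w \<in> range (\<lambda>x. x \<leftharpoonup> e)" "w \<noteq> 0" for w
    proof -
      from right_hom_nondegenerate[OF \<beta> that(2)] obtain z where "\<beta> w z \<noteq> 0" ..
      moreover have "w \<leftharpoonup> e = w" using that(1) ee(2) by auto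
      ultimately have "\<beta> w (e \<rightharpoonup> z) \<noteq> 0" using b[of w z] by simp
      then show ?thesis by blast
    qed
    show "Vector_Spaces.linear scale (*) (\<alpha> v)" "Vector_Spaces.linear scale (*) (\<beta> v)" for v
      using left_hom_dual[OF \<alpha>(1)] right_hom_dual[OF \<beta>(1)] by (simp_all add: dual_def)
    show "Vector_Spaces.linear scale (*) (\<lambda>v. \<alpha> v w)"
      "Vector_Spaces.linear scale (*) (\<lambda>v. \<beta> v w)" for w
      using left_hom_flip_dual[OF \<alpha>(1)] right_hom_flip_dual[OF \<beta>(1)] by (simp_all add: dual_def)
    show "range (left_act scale \<Delta> e) \<subseteq> span S" "range (\<lambda>x. x \<leftharpoonup> e) \<subseteq> span S'"
      using S(2) S'(2) by blast+
  qed (fact S(1) S'(1) dual_linear[OF eD])+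
  then obtain x where x: "\<And>w. \<alpha> (e \<rightharpoonup> x) (w \<leftharpoonup> e) = e (w \<leftharpoonup> e)" by blast
  have "\<alpha> (e \<rightharpoonup> x) = e"
  proof
    fix w
    have "\<alpha> (e \<rightharpoonup> x) w = \<alpha> (e \<rightharpoonup> x) (w \<leftharpoonup> e)" using a[of "e \<rightharpoonup> x" w] ee(1) by simp
    also have "\<dots> = e w" using x by (simp add: dual_apply_right_act eD idem)
    finally show "\<alpha> (e \<rightharpoonup> x) w = e w" .
  qed
  then show ?thesis by (metis rangeI)
qed

text \<open>The order of choices matters: first \<open>u\<close> with \<open>\<alpha>(x) = u\<alpha>(x)\<close>, then a finite set \<open>S\<close> spanning
  \<open>C \<cdot> u\<close>, and only then the idempotent, which has to fix the vectors \<open>s \<cdot> \<alpha>(x)\<close> in addition to \<open>X\<close>.\<close>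
lemma common_local_unit:
  assumes \<alpha>: "left_module_hom scale \<Delta> \<alpha>" "inj \<alpha>" and \<beta>: "right_module_hom scale \<Delta> \<beta>" "inj \<beta>"
    and X: "finite X"
  shows "\<exists>v. \<alpha> v \<star> \<alpha> v = \<alpha> v \<and> (\<forall>x\<in>X. \<alpha> v \<rightharpoonup> x = x \<and> \<alpha> x \<star> \<alpha> v = \<alpha> x)"
proof -
  obtain y where y: "\<And>x. x \<in> X \<Longrightarrow> (\<lambda>z. \<beta> z y) \<rightharpoonup> x = x"
    using left_approximate_unit[OF \<beta> X] by blast
  define u where "u = (\<lambda>z. \<beta> z y)"
  have uD: "u \<in> dual scale" unfolding u_def by (rule right_hom_flip_dual[OF \<beta>(1)])
  have ux: "u \<star> \<alpha> x = \<alpha> x" if "x \<in> X" for x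
    using left_hom_act[OF \<alpha>(1) uD, of x] y[OF that] by (simp add: u_def)
  obtain S where S: "finite S" "\<And>z. z \<leftharpoonup> u \<in> span S"
    using finite_rank(2)[OF \<alpha> \<beta>(1)] unfolding u_def by blast
  define Z where "Z = X \<union> (\<lambda>(x, s). s \<leftharpoonup> \<alpha> x) ` (X \<times> S)"
  have "finite Z" using X S(1) by (simp add: Z_def)
  from idempotent_left_unit[OF \<beta> this] obtain t
    where "(\<lambda>x. \<beta> x t) \<star> (\<lambda>x. \<beta> x t) = (\<lambda>x. \<beta> x t) \<and> (\<forall>z\<in>Z. (\<lambda>x. \<beta> x t) \<rightharpoonup> z = z)" ..
  then have t: "(\<lambda>x. \<beta> x t) \<star> (\<lambda>x. \<beta> x t) = (\<lambda>x. \<beta> x t)"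
    and tZ: "\<And>z. z \<in> Z \<Longrightarrow> (\<lambda>x. \<beta> x t) \<rightharpoonup> z = z"
    by simp_all
  define e where "e = (\<lambda>x. \<beta> x t)"
  have eD: "e \<in> dual scale" unfolding e_def by (rule right_hom_flip_dual[OF \<beta>(1)])
  have "e \<in> range \<alpha>" using idempotent_in_left_image[OF \<alpha> \<beta>] t unfolding e_def by blast
  then obtain v where v: "e = \<alpha> v" by blast
  have "\<alpha> x \<star> e = \<alpha> x" if "x \<in> X" for x
  proof
    fix z
    have aD: "\<alpha> x \<in> dual scale" using \<alpha>(1) by (rule left_hom_dual)
    interpret R: Vector_Spaces.linear scale scale "\<lambda>z. z \<leftharpoonup> \<alpha> x" by (rule linear_right_act[OF aD])
    interpret E: Vector_Spaces.linear scale "(*)" e by (rule dual_linear[OF eD])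
    interpret N: Vector_Spaces.linear scale "(*)" \<epsilon> by (rule counit_linear)
    have agree: "e (s \<leftharpoonup> \<alpha> x) = \<epsilon> (s \<leftharpoonup> \<alpha> x)" if "s \<in> S" for s
    proof -
      have "s \<leftharpoonup> \<alpha> x \<in> Z" using that \<open>x \<in> X\<close> by (auto simp: Z_def)
      then have "e \<rightharpoonup> (s \<leftharpoonup> \<alpha> x) = s \<leftharpoonup> \<alpha> x" unfolding e_def by (rule tZ)
      then show ?thesis
        using dual_apply_left_act[OF counit_dual, of e] conv_counit_left[OF eD] by metis
    qed
    have "span S \<subseteq> {z. e (z \<leftharpoonup> \<alpha> x) = \<epsilon> (z \<leftharpoonup> \<alpha> x)}"
      by (rule span_minimal) (use agree in \<open>auto simp: subspace_def R.add R.scale R.zero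
          E.add E.scale E.zero N.add N.scale N.zero\<close>)
    then have "e (z \<leftharpoonup> u \<leftharpoonup> \<alpha> x) = \<epsilon> (z \<leftharpoonup> u \<leftharpoonup> \<alpha> x)" using S(2) by blast
    moreover have "z \<leftharpoonup> u \<leftharpoonup> \<alpha> x = z \<leftharpoonup> \<alpha> x"
      using right_act_conv[OF uD aD] ux[OF that] by simp
    ultimately show "(\<alpha> x \<star> e) z = \<alpha> x z"
      using eD counit_dual aD by (simp add: dual_apply_right_act conv_counit_right)
  qed
  moreover have "e \<rightharpoonup> x = x" if "x \<in> X" for x
    unfolding e_def using that by (intro tZ) (simp add: Z_def)
  ultimately show ?thesis
    using t[folded e_def] by (intro exI[of _ v]) (simp flip: v)
qed

lemma circ_eq_left_act:
  assumes "left_module_hom scale \<Delta> \<alpha>" "inj \<alpha>"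
  shows "circ \<Delta> \<alpha> x y = \<alpha> x \<rightharpoonup> y"
  using assms unfolding circ_def
  by (simp add: left_hom_act[symmetric] left_hom_dual inv_f_f)

end

theorem theorem3p2:
  fixes scale :: "'k::field \<Rightarrow> 'a::ab_group_add \<Rightarrow> 'a"
    and \<Delta> :: "'a \<Rightarrow> ('a \<times> 'a \<Rightarrow>\<^sub>0 'k) set"
    and \<epsilon> :: "'a \<Rightarrow> 'k"
    and \<alpha> :: "'a \<Rightarrow> 'a \<Rightarrow> 'k"
  assumes "coalgebra scale \<Delta> \<epsilon>"
    and "co_Frobenius scale \<Delta>"
    and "left_module_hom scale \<Delta> \<alpha>"
    and "inj \<alpha>"
  shows "class.ring (+) 0 (-) uminus (circ \<Delta> \<alpha>)
    \<and> has_local_units (circ \<Delta> \<alpha>)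
    \<and> (\<forall>c\<in>dual scale. \<forall>x y.
        circ \<Delta> \<alpha> (left_act scale \<Delta> c x) y = left_act scale \<Delta> c (circ \<Delta> \<alpha> x y)
      \<and> circ \<Delta> \<alpha> x (right_act scale \<Delta> y c) = right_act scale \<Delta> (circ \<Delta> \<alpha> x y) c)"
proof -
  interpret coalgebra scale \<Delta> \<epsilon> by fact
  note \<alpha> = assms(3,4)
  note circ = circ_eq_left_act[OF \<alpha>]
  have aD: "\<alpha> x \<in> dual scale" for x using \<alpha>(1) by (rule left_hom_dual)
  have act: "\<alpha> (left_act scale \<Delta> f x) = conv \<Delta> f (\<alpha> x)" if "f \<in> dual scale" for f x
    using \<alpha>(1) that by (rule left_hom_act)
  have add: "\<alpha> (x + y) = (\<lambda>z. \<alpha> x z + \<alpha> y z)" for x y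
    using \<alpha>(1) unfolding left_module_hom_def by blast
  interpret L: Vector_Spaces.linear scale scale "left_act scale \<Delta> (\<alpha> x)" for x
    by (rule linear_left_act[OF aD])
  have "class.ring (+) 0 (-) uminus (circ \<Delta> \<alpha>)"
    by unfold_locales
      (simp_all add: circ act aD left_act_conv add left_act_add L.add)
  moreover have "has_local_units (circ \<Delta> \<alpha>)"
    unfolding has_local_units_def
  proof (intro allI impI)
    fix X :: "'a set" assume "finite X"
    obtain \<beta> where \<beta>: "right_module_hom scale \<Delta> \<beta>" "inj \<beta>"
      using assms(2) by (auto simp: co_Frobenius_def right_co_Frobenius_def)
    obtain v where v: "conv \<Delta> (\<alpha> v) (\<alpha> v) = \<alpha> v"
      and vX: "\<And>x. x \<in> X \<Longrightarrow> left_act scale \<Delta> (\<alpha> v) x = x \<and> conv \<Delta> (\<alpha> x) (\<alpha> v) = \<alpha> x"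
      using common_local_unit[OF \<alpha> \<beta> \<open>finite X\<close>] by blast
    have "circ \<Delta> \<alpha> v v = v" unfolding circ_def v by (rule inv_f_f[OF \<alpha>(2)])
    moreover have "circ \<Delta> \<alpha> v x = x \<and> circ \<Delta> \<alpha> x v = x" if "x \<in> X" for x
      using vX[OF that] circ[of v x] by (simp add: circ_def inv_f_f[OF \<alpha>(2)])
    ultimately show "\<exists>e. circ \<Delta> \<alpha> e e = e \<and> (\<forall>x\<in>X. circ \<Delta> \<alpha> e x = x \<and> circ \<Delta> \<alpha> x e = x)"
      by blast
  qed
  ultimately show ?thesis
    by (simp add: circ act aD left_act_conv left_right_act)
qed

end
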